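(* Let $n$ and $\omega$ be positive integers with $\lfloor 3n/4\rfloor\le\omega\le n-1$, and let $\mathbf{u}$ be a binary sequence with least period $n$. Then $nlc(\mathbf{u})=\omega$ if and only if some block of $n$ consecutive terms of $\mathbf{u}$, written $\mathbf{s}_n=(s_0,s_1,\dots,s_{n-1})$, has one of the following two forms. (i) For some $d$ with $1\le d\le n-\omega-1$: $$\mathbf{s}_n=\big((s_0,\dots,s_{d-1})^{q}\,(s_0,\dots,s_{r-1},\overline{s_r})\,(s_{\omega+d},\dots,s_{n-2})\,\overline{s_{d-1}}\big),$$ where the first part $(s_0,\dots,s_{d-1})^{q}(s_0,\dots,s_{r-1},\overline{s_r})$ has length $\omega+d$, $q=\lfloor(\omega+d-1)/d\rfloor$, $0\le r=(\omega+d-1)-qd<d$, $\mathbf{s}_d=(s_0,\dots,s_{d-1})$ is aperiodic, the block $(s_{\omega+d},\dots,s_{n-2})$ is an arbitrary element of $\mathbb{Z}_2^{\,n-\omega-d-1}$, and the last term is $s_{n-1}=\overline{s_{d-1}}$. (ii) For some $d$ with $n-\omega\le d\le\lfloor n/2\rfloor$: $$\mathbf{s}_n=\big((s_0,\dots,s_{d-1})^{q'}\,(s_0,\dots,s_{r'-1},\overline{s_{r'}})\big),$$ where $q'=\lfloor (n-1)/d\rfloor$, $0\le r'=(n-1)-q'd<d$, and the aperiodic sequence $\mathbf{s}_d=(s_0,\dots,s_{d-1})$ satisfies, with $t=\omega+d-n$: if $t=0$ then $s_{(n-1)\bmod d}=s_{d-1}$; if $t>0$ then $\overline{s_{(n-1)\bmod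 d}}=s_{d-1}$, $s_{(n-i)\bmod d}=s_{(d-i)\bmod d}$ for $2\le i\le t$, and $s_{(n-t-1)\bmod d}=\overline{s_{(d-t-1)\bmod d}}$.
   Context: All sequences are binary, with entries in $\mathbb{Z}_2$, and $\overline{x}=x\oplus1$. For a finite sequence $\mathbf{a}$ and an integer $q\ge1$, $\mathbf{a}^q$ is the concatenation of $q$ copies of $\mathbf{a}$; juxtaposition of blocks denotes concatenation. A finite sequence of length $m$ is periodic if it equals $\mathbf{a}^{m/e}$ for some sequence $\mathbf{a}$ of length $e$, $e$ a proper divisor of $m$; otherwise it is aperiodic. $x\bmod d$ denotes the least nonnegative residue. The nonlinear complexity $nlc(\mathbf{u})$ of a (finite or infinite) sequence $\mathbf{u}=(u_0,u_1,\dots)$ is the length of the shortest feedback shift register generating it, i.e. the least integer $L\ge0$ for which there is a function $f:\mathbb{Z}_2^L\to\mathbb{Z}_2$ with $u_{i+L}=f(u_i,\dots,u_{i+L-1})$ for all $i$ for which $u_{i+L}$ is defined. *)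

theory Defs
  imports Main
begin

text \<open>Binary sequences: entries in Z_2 are modelled as bool; complement is negation.
  Infinite sequences are functions nat => bool; finite sequences (s_0,...,s_{m-1})
  are functions nat => bool of which only the indices < m matter.\<close>

definition nlc :: "(nat \<Rightarrow> bool) \<Rightarrow> nat" where
  "nlc u = (LEAST L. \<exists>f :: bool list \<Rightarrow> bool.
              \<forall>i. u (i + L) = f (map (\<lambda>j. u (i + j)) [0..<L]))"

definition least_period :: "(nat \<Rightarrow> bool) \<Rightarrow> nat \<Rightarrow> bool" where
  "least_period u n \<longleftrightarrow> 0 < n \<and> (\<forall>i. u (i + n) = u i)
     \<and> (\<forall>p. 0 < p \<and> p < n \<longrightarrow> \<not> (\<forall>i. u (i + p) = u i))"

definition aperiodic :: "nat \<Rightarrow> (nat \<Rightarrow> bool) \<Rightarrow> bool" where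
  "aperiodic m s \<longleftrightarrow> \<not> (\<exists>e. e dvd m \<and> e < m \<and> (\<forall>j<m. s j = s (j mod e)))"

definition form_i :: "nat \<Rightarrow> nat \<Rightarrow> nat \<Rightarrow> (nat \<Rightarrow> bool) \<Rightarrow> bool" where
  "form_i n \<omega> d s \<longleftrightarrow>
     (let q = (\<omega> + d - 1) div d; r = (\<omega> + d - 1) - q * d in
       aperiodic d s
       \<and> (\<forall>j < q * d. s j = s (j mod d))
       \<and> (\<forall>j < r. s (q * d + j) = s j)
       \<and> s (q * d + r) = (\<not> s r)
       \<and> s (n - 1) = (\<not> s (d - 1)))"

definition form_ii :: "nat \<Rightarrow> nat \<Rightarrow> nat \<Rightarrow> (nat \<Rightarrow> bool) \<Rightarrow> bool" where
  "form_ii n \<omega> d s \<longleftrightarrow>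
     (let q' = (n - 1) div d; r' = (n - 1) - q' * d; t = \<omega> + d - n in
       aperiodic d s
       \<and> (\<forall>j < q' * d. s j = s (j mod d))
       \<and> (\<forall>j < r'. s (q' * d + j) = s j)
       \<and> s (q' * d + r') = (\<not> s r')
       \<and> (t = 0 \<longrightarrow> s ((n - 1) mod d) = s (d - 1))
       \<and> (t > 0 \<longrightarrow>
             (\<not> s ((n - 1) mod d)) = s (d - 1)
             \<and> (\<forall>i. 2 \<le> i \<and> i \<le> t \<longrightarrow> s ((n - i) mod d) = s ((d - i) mod d))
             \<and> s ((n - t - 1) mod d) = (\<not> s ((d - t - 1) mod d))))"

end

(* A match of length L at shift d consists of L consecutive i with u(i + d) = u(i), followed by a
   mismatch; nlc u is one more than the length of the longest match. A match of length \<omega> - 1 that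
   cannot be prolonged to the left spans a window of \<omega> + d - 1 terms of period d. The forms (i) and
   (ii) describe this window: (i) starts at its first term, and (ii) starts \<omega> + d - n terms later, as
   the window then has at least n - 1 terms. It remains to see that such a match with a primitive
   window excludes a longer match, say of length \<omega>' - 1 at shift d'. The second difference
   u(i) + u(i + d) + u(i + d') + u(i + d + d') vanishes on maximal runs of lengths \<omega> - 1 - d' and
   \<omega>' - 1 - d, one for each match. If the runs coincide, so do the windows, which contradicts the
   theorem of Fine and Wilf. If they are disjoint, then either the shifts are so small that Fine and
   Wilf applies to an overlap of the windows, or one run lies in a gap that the mismatches of the
   other match leave; since \<omega> >= floor(3n/4), counting excludes the latter but for one family of
   parameters. *)
theory Submission
  imports Defs
begin


section \<open>Periods of windows and the theorem of Fine and Wilf\<close>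

text \<open>Windows are half-open integer intervals, so that they may reach to the left of index 0.
  A window of at most \<open>e\<close> terms satisfies this vacuously.\<close>

definition per :: "(int \<Rightarrow> bool) \<Rightarrow> int \<Rightarrow> int \<Rightarrow> int \<Rightarrow> bool" where
  "per U a b e \<longleftrightarrow> (\<forall>i. a \<le> i \<and> i + e < b \<longrightarrow> U (i + e) = U i)"

lemma perD: "per U a b e \<Longrightarrow> a \<le> i \<Longrightarrow> i + e < b \<Longrightarrow> U (i + e) = U i"
  unfolding per_def by blast

lemma per_mono: "per U a b e \<Longrightarrow> a \<le> a' \<Longrightarrow> b' \<le> b \<Longrightarrow> per U a' b' e"
  unfolding per_def by auto

lemma per_mult:
  assumes "per U a b e" "0 \<le> e" "a \<le> i" "i + int k * e < b"
  shows "U (i + int k * e) = U i"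
  using assms(4)
proof (induction k)
  case (Suc k)
  have eq: "i + int (Suc k) * e = (i + int k * e) + e" by (simp add: algebra_simps)
  have k: "0 \<le> int k * e" using assms(2) by simp
  have "U ((i + int k * e) + e) = U (i + int k * e)"
    using Suc.prems assms(3) k unfolding eq by (intro perD[OF assms(1)]) linarith+
  moreover have "U (i + int k * e) = U i"
    using Suc.prems assms(2) unfolding eq by (intro Suc.IH) linarith
  ultimately show ?case unfolding eq by simp
qed simp

lemma per_cong:
  assumes "per U a b e" "0 < e" "a \<le> i" "i < b" "a \<le> j" "j < b" "e dvd j - i"
  shows "U i = U j"
proof -
  have *: "U x = U y" if "a \<le> x" "y < b" "x \<le> y" "e dvd y - x" for x y
  proof -
    from that(4) obtain m where m: "y - x = e * m" ..
    then have "0 \<le> m" using that(3) assms(2) by (smt (verit) mult_pos_neg)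
    then have y: "y = x + int (nat m) * e" using m by (simp add: algebra_simps)
    show ?thesis using per_mult[OF assms(1), of x "nat m"] that assms(2) y by simp
  qed
  show ?thesis
  proof (cases "i \<le> j")
    case True then show ?thesis using * assms by blast
  next
    case False
    moreover have "e dvd i - j" using assms(7) by (metis dvd_minus_iff minus_diff_eq)
    ultimately show ?thesis using *[of j i] assms by simp
  qed
qed

text \<open>Every residue class modulo \<open>d\<close> meets the inner window, so each outer term
  equals an inner one whose index (\<open>rep\<close>) differs by a multiple of \<open>d\<close>,
  hence of \<open>e\<close>.\<close>

lemma per_extend:
  assumes "per U a b d" "0 < e" "0 < d" "e dvd d"
    and "per U a' b' e" "a \<le> a'" "b' \<le> b" "d \<le> b' - a'"
  shows "per U a b e"
  unfolding per_def
proof (intro allI impI, elim conjE)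
  fix i assume i: "a \<le> i" "i + e < b"
  define rep where "rep x = a' + (x - a') mod d" for x
  have rep: "a' \<le> rep x" "rep x < b'" "d dvd rep x - x" for x
  proof -
    have "0 \<le> (x - a') mod d" "(x - a') mod d < d" using assms(3) by auto
    then show "a' \<le> rep x" "rep x < b'" unfolding rep_def using assms(8) by linarith+
    have "rep x - x = - ((x - a') - (x - a') mod d)" unfolding rep_def by simp
    then show "d dvd rep x - x" by (metis dvd_minus_iff dvd_minus_mod)
  qed
  have "U x = U (rep x)" if "a \<le> x" "x < b" for x
    using per_cong[OF assms(1,3) that, of "rep x"] rep[of x] assms(6,7) by linarith
  then have "U i = U (rep i)" "U (i + e) = U (rep (i + e))" using i assms(2) by auto
  moreover have "e dvd rep (i + e) - rep i"
  proof -
    have "e dvd rep x - x" for x using rep(3) assms(4) dvd_trans by blast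
    from dvd_add[OF dvd_diff[OF this[of "i + e"] this[of i]] dvd_refl[of e]]
    show ?thesis by simp
  qed
  then have "U (rep i) = U (rep (i + e))"
    using per_cong[OF assms(5,2) rep(1,2) rep(1,2)] by blast
  ultimately show "U (i + e) = U i" by simp
qed

text \<open>Subtractive Euclidean algorithm: for \<open>p < q\<close>, dropping the last
  \<open>p\<close> terms leaves a window with periods \<open>p\<close> and \<open>q - p\<close>. The
  period found there extends back because \<open>p\<close> is a period of the whole window.\<close>

lemma Fine_Wilf:
  assumes "0 < p" "0 < q" "per U a b p" "per U a b q" "p + q - gcd p q \<le> b - a"
  shows "per U a b (gcd p q)"
  using assms
proof (induction "nat (p + q)" arbitrary: p q b rule: less_induct)
  case less
  have main: "per U a b (gcd p q)"
    if pq: "0 < p" "p < q" and P: "per U a b p" and Q: "per U a b q"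
      and len: "p + q - gcd p q \<le> b - a"
      and IH: "\<And>p' q' b'. nat (p' + q') < nat (p + q) \<Longrightarrow> 0 < p' \<Longrightarrow> 0 < q' \<Longrightarrow> per U a b' p'
        \<Longrightarrow> per U a b' q' \<Longrightarrow> p' + q' - gcd p' q' \<le> b' - a \<Longrightarrow> per U a b' (gcd p' q')"
    for p q b
  proof -
    have g: "gcd p (q - p) = gcd p q" by (metis gcd.commute gcd_diff1)
    have Q': "per U a (b - p) (q - p)"
      unfolding per_def
    proof (intro allI impI, elim conjE)
      fix i assume i: "a \<le> i" "i + (q - p) < b - p"
      have "U (i + (q - p) + p) = U (i + (q - p))" using P i pq by (intro perD) auto
      moreover have "U (i + q) = U i" using Q i pq by (intro perD) auto
      ultimately show "U (i + (q - p)) = U i" by simp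
    qed
    have "per U a (b - p) (gcd p (q - p))"
      using pq len Q' P by (intro IH) (auto simp: g intro: per_mono)
    \<comment> \<open>This makes the shortened window at least \<open>p\<close> long, as the
      extension requires.\<close>
    moreover have "gcd p q \<le> q - p"
      using pq gcd_le2_int[of "q - p" p] g by simp
    ultimately show ?thesis
      using pq len g by (intro per_extend[OF P, of "gcd p q" a "b - p"]) auto
  qed
  consider "p = q" | "p < q" | "q < p" by linarith
  then show ?case
  proof cases
    case 1 then show ?thesis using less by simp
  next
    case 2 show ?thesis using main[OF less.prems(1) 2] less.prems less.hyps by blast
  next
    case 3
    have "per U a b (gcd q p)"
      using main[OF less.prems(2) 3] less.prems less.hyps by (simp add: gcd.commute add.commute)
    then show ?thesis by (simp add: gcd.commute)
  qed
qed

text \<open>The overlap has period \<open>gcd d d'\<close>, which spreads to the first window, so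
  primitivity makes it equal to \<open>d\<close>. Then \<open>d\<close> is a period of the second
  window too, and an overhang of that window would contradict one of the mismatches that bound the
  first.\<close>

lemma Fine_Wilf_overlap:
  assumes pos: "0 < d" "0 < d'"
    and per1: "per U a b d" and max1: "U (a - 1 + d) \<noteq> U (a - 1)" "U b \<noteq> U (b - d)"
    and prim: "\<And>e. 0 < e \<Longrightarrow> e dvd d \<Longrightarrow> per U a b e \<Longrightarrow> e = d"
    and per2: "per U a' b' d'"
    and ov: "d + d' - gcd d d' \<le> min b b' - max a a'"
  shows "a \<le> a'" "b' \<le> b" "d dvd d'"
proof -
  let ?a = "max a a'" and ?b = "min b b'" and ?g = "gcd d d'"
  have g: "0 < ?g" "?g \<le> d" "?g \<le> d'" using pos by (auto simp: gcd_le1_int gcd_le2_int)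
  have pg: "per U ?a ?b ?g"
    using pos ov by (intro Fine_Wilf per_mono[OF per1] per_mono[OF per2]) auto
  have "per U a b ?g"
    using per_extend[OF per1 g(1) pos(1) _ pg] ov g by simp
  then have gd: "?g = d" using prim g by simp
  then show "d dvd d'" by (metis gcd_dvd2)
  have per2': "per U a' b' d"
    using per_extend[OF per2 pos \<open>d dvd d'\<close> pg[unfolded gd]] ov g gd by simp
  have len: "d \<le> ?b - ?a" using ov g gd by linarith
  show "a \<le> a'"
  proof (rule ccontr)
    assume "\<not> a \<le> a'"
    then show False using perD[OF per2', of "a - 1"] max1(1) len by linarith
  qed
  show "b' \<le> b"
  proof (rule ccontr)
    assume "\<not> b' \<le> b"
    then show False using perD[OF per2', of "b - d"] max1(2) len by simp linarith
  qed
qed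

section \<open>Incompatibility of two maximal matches\<close>

text \<open>\<open>v\<close> and its translate by \<open>e\<close> differ at
  \<open>n - 1 - e\<close> and at \<open>\<omega> - 1\<close>. The run therefore lies in one of the
  three gaps that these positions leave between \<open>\<omega> - e\<close> and
  \<open>n - 2\<close>; the two outer gaps have \<open>n - \<omega> - 1\<close> positions
  each.\<close>

lemma zero_run_gap:
  fixes n \<omega> e b B :: int
  assumes vper: "\<And>i. v (i + n) = v i"
    and zero: "\<And>i. 0 \<le> i \<Longrightarrow> i < \<omega> - 1 \<Longrightarrow> \<not> v i" and one: "v (- 1)" "v (\<omega> - 1)"
    and e: "n - \<omega> + 1 \<le> e" "e < n" "\<omega> \<le> n - 1"
    and b: "\<omega> - e \<le> b" "b + B \<le> n - 1"
    and run: "\<And>i. b \<le> i \<Longrightarrow> i < b + B \<Longrightarrow> v i = v (i + e)"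
  shows "B \<le> n - \<omega> - 1 \<or> B \<le> \<omega> + e - n - 1"
proof -
  have "v (n - 1)" using vper[of "-1"] one by simp
  then have 1: "v (n - 1 - e) \<noteq> v (n - 1 - e + e)" using zero[of "n - 1 - e"] e by simp
  have "\<not> v (\<omega> - 1 + e)" using vper[of "\<omega> - 1 + e - n"] zero[of "\<omega> - 1 + e - n"] e by simp
  then have 2: "v (\<omega> - 1) \<noteq> v (\<omega> - 1 + e)" using one by simp
  have "n - 1 - e < b \<or> b + B \<le> n - 1 - e" using 1 run[of "n - 1 - e"] by force
  moreover have "\<omega> - 1 < b \<or> b + B \<le> \<omega> - 1" using 2 run[of "\<omega> - 1"] by force
  ultimately show ?thesis using b e by linarith
qed


text \<open>If \<open>n = 2 * d\<close>, two shifts by \<open>d\<close> return to the start, so the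
  mismatch at \<open>a - 1\<close> recurs at \<open>a - 1 + d\<close>, which lies in the
  run.\<close>

lemma half_period_less:
  fixes U :: "int \<Rightarrow> bool"
  assumes nper: "\<And>i. U (i + n) = U i" and "0 < d" "2 * d \<le> n" "d < \<omega>"
    and run: "\<And>i. a \<le> i \<Longrightarrow> i < a + \<omega> - 1 \<Longrightarrow> U (i + d) = U i"
    and ne: "U (a - 1 + d) \<noteq> U (a - 1)"
  shows "2 * d < n"
proof (rule ccontr)
  assume "\<not> 2 * d < n"
  then have n: "n = d + d" using assms by simp
  have "U (a - 1 + d + d) = U (a - 1 + d)" using run[of "a - 1 + d"] assms by simp
  moreover have "U (a - 1 + d + d) = U (a - 1)" using nper[of "a - 1"] n by (simp add: add.assoc)
  ultimately show False using ne by simp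
qed

text \<open>The origin is the start of the first match, and \<open>b\<close> is the start of the
  second one modulo \<open>n\<close>. As with \<open>\<omega>\<close>, the number
  \<open>\<omega>'\<close> is one more than the length of its match.\<close>

lemma maximal_runs_conflict:
  fixes U :: "int \<Rightarrow> bool" and n \<omega> \<omega>' d d' b :: int
  assumes nper: "\<And>i. U (i + n) = U i"
    and d: "0 < d" "2 * d \<le> n" and d': "0 < d'" "2 * d' \<le> n"
    and \<omega>: "0 < \<omega>" "3 * n div 4 \<le> \<omega>" "\<omega> < \<omega>'" "\<omega>' \<le> n - 1"
    and b: "0 \<le> b" "b < n"
    and run1: "\<And>i. 0 \<le> i \<Longrightarrow> i < \<omega> - 1 \<Longrightarrow> U (i + d) = U i"
    and ne1: "U (- 1 + d) \<noteq> U (- 1)" "U (\<omega> - 1 + d) \<noteq> U (\<omega> - 1)"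
    and prim: "\<And>e. 0 < e \<Longrightarrow> e dvd d \<Longrightarrow> per U 0 (\<omega> + d - 1) e \<Longrightarrow> e = d"
    and run2: "\<And>i. b \<le> i \<Longrightarrow> i < b + \<omega>' - 1 \<Longrightarrow> U (i + d') = U i"
    and ne2: "U (b - 1 + d') \<noteq> U (b - 1)" "U (b + \<omega>' - 1 + d') \<noteq> U (b + \<omega>' - 1)"
  shows False
proof -
  \<comment> \<open>All the counting below uses the floor in this form.\<close>
  have \<omega>4: "3 * n \<le> 4 * \<omega> + 3" using \<omega>(2) by presburger
  have n3: "3 \<le> n" using \<omega> by linarith
  have lt: "d < \<omega>" "d' < \<omega>" 
  proof -
    have "e < \<omega>" if "2 * e \<le> n" for e
    proof (rule ccontr)
      assume "\<not> e < \<omega>"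
      then have "n = 3" using that \<omega>4 n3 by linarith
      then show False using that \<open>\<not> e < \<omega>\<close> \<omega>4 by presburger
    qed
    then show "d < \<omega>" "d' < \<omega>" using d d' by auto
  qed
  have D: "2 * d < n" "2 * d' < n"
  proof -
    show "2 * d < n"
      by (rule half_period_less[where U = U and a = 0, OF nper d lt(1) run1]) (use ne1 in simp_all)
    show "2 * d' < n"
      by (rule half_period_less[where U = U and a = b and \<omega> = \<omega>', OF nper d' _ run2 ne2(1)])
        (use lt \<omega> in auto)
  qed
  \<comment> \<open>\<open>v\<close> and \<open>w\<close> mark the mismatches at the two shifts.
    Their second difference \<open>x\<close> is symmetric in the shifts and so sees both
    matches.\<close>
  define v where "v i \<longleftrightarrow> U (i + d) \<noteq> U i" for i
  define w where "w i \<longleftrightarrow> U (i + d') \<noteq> U i" for i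
  define x where "x i \<longleftrightarrow> v i \<noteq> v (i + d')" for i
  have vw: "v i \<noteq> v (i + d') \<longleftrightarrow> w i \<noteq> w (i + d)" for i
    unfolding v_def w_def by (auto simp: algebra_simps)
  have vn: "v (i + n) = v i" and wn: "w (i + n) = w i" and xn: "x (i + n) = x i" for i
    using nper[of i] nper[of "i + d"] nper[of "i + d'"] nper[of "i + d + d'"]
    unfolding v_def w_def x_def by (auto simp: algebra_simps)
  have v0: "\<not> v i" if "0 \<le> i" "i < \<omega> - 1" for i using run1 that unfolding v_def by simp
  have v1: "v (- 1)" "v (\<omega> - 1)" using ne1 unfolding v_def by simp_all
  have w0: "\<not> w i" if "b \<le> i" "i < b + \<omega>' - 1" for i using run2 that unfolding w_def by simp
  have w1: "w (b - 1)" "w (b + \<omega>' - 1)" using ne2 unfolding w_def by simp_all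
  \<comment> \<open>\<open>A\<close> and \<open>B\<close> are the lengths of the zero runs of
    \<open>x\<close>: each match loses the shift of the other.\<close>
  define A where "A = \<omega> - 1 - d'"
  define B where "B = \<omega>' - 1 - d"
  have AB: "0 \<le> A" "0 \<le> B" using lt \<omega> unfolding A_def B_def by linarith+
  have xw: "x i \<longleftrightarrow> w i \<noteq> w (i + d)" for i unfolding x_def by (rule vw)
  have xA: "\<not> x i" if "0 \<le> i" "i < A" for i
    using v0[of i] v0[of "i + d'"] that d' unfolding x_def A_def by simp
  have xA1: "x (- 1)" "x A"
    using v0[of A] v0[of "- 1 + d'"] v1 AB lt d' unfolding x_def A_def by auto
  have xB: "\<not> x i" if "b \<le> i" "i < b + B" for i
    using w0[of i] w0[of "i + d"] that d unfolding xw B_def by simp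
  have xB1: "x (b - 1)" "x (b + B)"
    using w0[of "b + B"] w0[of "b - 1 + d"] w1 AB lt \<omega> d unfolding xw B_def by (auto simp: algebra_simps)
  have xn1: "x (n - 1)" using xn[of "- 1"] xA1 by simp

  define g where "g = gcd d d'"
  have g: "0 < g" "g \<le> d" "g \<le> d'" "d = d' \<Longrightarrow> g = d"
    using d d' by (auto simp: g_def gcd_le1_int gcd_le2_int)
  \<comment> \<open>The second window recurs with period \<open>n\<close>; its copies starting at
    \<open>b\<close> and at \<open>b - n\<close> are both compared with the first window.\<close>
  have no_overlap: "min (\<omega> + d - 1) (b - j + \<omega>' + d' - 1) - max 0 (b - j) < d + d' - g"
    if "j \<in> {0, n}" for j
  proof (rule ccontr)
    assume "\<not> ?thesis"
    then have ov: "d + d' - gcd d d' \<le> min (\<omega> + d - 1) (b - j + \<omega>' + d' - 1) - max 0 (b - j)"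
      unfolding g_def by linarith
    have "per U 0 (\<omega> + d - 1) d" using run1 unfolding per_def by simp
    moreover have "U (0 - 1 + d) \<noteq> U (0 - 1)" "U (\<omega> + d - 1) \<noteq> U (\<omega> + d - 1 - d)"
      using ne1 by (simp_all add: algebra_simps)
    moreover have "per U (b - j) (b - j + \<omega>' + d' - 1) d'"
      unfolding per_def
    proof (intro allI impI, elim conjE)
      fix i assume "b - j \<le> i" "i + d' < b - j + \<omega>' + d' - 1"
      then have "U (i + j + d') = U (i + j)" by (intro run2) linarith+
      moreover have "U (i + j) = U i" "U (i + j + d') = U (i + d')"
        using that nper[of i] nper[of "i + d'"] by (auto simp: algebra_simps)
      ultimately show "U (i + d') = U i" by simp
    qed
    ultimately have *: "0 \<le> b - j" "b - j + \<omega>' + d' - 1 \<le> \<omega> + d - 1" "d dvd d'"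
      using Fine_Wilf_overlap[where U = U, OF d(1) d'(1) _ _ _ prim _ ov] by blast+
    have "d \<le> d'" using *(3) d' by (simp add: zdvd_imp_le)
    then show False using * \<omega> by linarith
  qed
  have ov: "b < n" "(b + \<omega>' + d' \<le> \<omega> + d \<Longrightarrow> \<omega>' - 1 < d - g)"
     "\<omega> + d < b + \<omega>' + d' \<Longrightarrow> \<omega> - 1 - b < d' - g"
     "b - n + \<omega>' + d' - 1 < d + d' - g \<or> \<omega> - 1 < d' - g"
    using no_overlap[of 0] no_overlap[of n] b by (auto simp: min_def max_def split: if_splits)
  \<comment> \<open>With equal shifts \<open>g = d\<close>, and the overlap bounds give \<omega>
    \<le> b \<le> n - \<omega>', which is impossible.\<close>
  have dd: "d \<noteq> d'"
  proof
    assume "d = d'"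
    then have "g = d" using g by simp
    then show False using ov \<omega> lt D d d' \<omega>4 \<open>d = d'\<close> by linarith
  qed
  \<comment> \<open>A common start forces \<open>A = B\<close>, that is \<omega> + d = \<omega>' +
    d', so the two windows coincide.\<close>
  have "b \<noteq> 0"
  proof
    assume "b = 0"
    then have "B \<ge> A" "A \<ge> B" using xA xA1 xB xB1 AB by force+
    then show False using ov g lt \<omega> \<open>b = 0\<close> unfolding A_def B_def by linarith
  qed
  \<comment> \<open>The ones of \<open>x\<close> at \<open>b - 1\<close> and \<open>n - 1\<close>
    separate the two zero runs.\<close>
  then have sep: "A + 1 \<le> b" "b + B \<le> n - 1"
    using xA[of "b - 1"] xB1 xB[of "n - 1"] xn1 b by (force, force)

  \<comment> \<open>The middle gap is too short, since \<open>d + d' < n\<close> and \<omega> <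
    \<omega>'.\<close>
  have gap1: "B \<le> n - \<omega> - 1" if "n - \<omega> + 1 \<le> d'"
  proof -
    have "B \<le> n - \<omega> - 1 \<or> B \<le> \<omega> + d' - n - 1"
      using sep that D d' \<omega> xB
      by (intro zero_run_gap[where v = v, OF vn v0 v1, where b = b]) (auto simp: A_def x_def)
    then show ?thesis using D \<omega> unfolding B_def by linarith
  qed
  \<comment> \<open>The roles are exchanged: seen from \<open>b\<close>, the first zero run starts
    at \<open>n - b\<close>, after a translation by \<open>n\<close>.\<close>
  have gap2: "A \<le> n - \<omega>' - 1 \<or> A \<le> \<omega>' + d - n - 1" if "n - \<omega>' + 1 \<le> d"
  proof (rule zero_run_gap[where v = "\<lambda>i. w (b + i)" and b = "n - b" and e = d])
    fix i
    show "w (b + (i + n)) = w (b + i)" using wn[of "b + i"] by (simp add: algebra_simps)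
    show "\<not> w (b + i)" if "0 \<le> i" "i < \<omega>' - 1" using that by (intro w0) auto
    show "w (b + i) = w (b + (i + d))" if "n - b \<le> i" "i < n - b + A"
      using xA[of "b + i - n"] xn[of "b + i - n"] that xw[of "b + i"] by (auto simp: algebra_simps)
  qed (use w1 sep that D d \<omega> B_def in \<open>auto simp: algebra_simps\<close>)

  (* The extremal parameters: n = 4k+1, \<omega> = 3k, \<omega>' = 4k, d = 2k, d' = k+1 survive the counting. *)
  have cases: "2 * d = n - 1" "\<omega>' = n - 1" "d' = n - \<omega>" "4 * \<omega> = 3 * n - 3"
  proof -
    \<comment> \<open>The cases record for which of the two shifts the gap argument is
      available.\<close>
    consider "n - \<omega> + 1 \<le> d'" "n - \<omega>' + 1 \<le> d" | "n - \<omega> + 1 \<le> d'" "d \<le> n - \<omega>'"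
      | "d' \<le> n - \<omega>" "n - \<omega>' + 1 \<le> d" | "d' \<le> n - \<omega>" "d \<le> n - \<omega>'"
      by linarith
    then have "2 * d = n - 1 \<and> \<omega>' = n - 1 \<and> d' = n - \<omega> \<and> 4 * \<omega> = 3 * n - 3"
    proof cases
      case 1
      have "d = d'"
        using gap2[OF 1(2)] gap1[OF 1(1)] D \<omega>(3,4) \<omega>4 unfolding A_def B_def by linarith
      then show ?thesis using dd by simp
    next
      case 2
      then show ?thesis using gap1[OF 2(1)] D \<omega>(3,4) \<omega>4 n3 unfolding B_def by linarith
    next
      case 3
      from gap2[OF 3(2)] show ?thesis
      proof
        assume *: "A \<le> n - \<omega>' - 1"
        then have "n \<le> 5" using 3 \<omega>(3) \<omega>4 unfolding A_def by linarith
        then consider "n = 3" | "n = 4" | "n = 5" using n3 by linarith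
        then have "d = d'" using 3 * \<omega>(3,4) \<omega>4 D d d' unfolding A_def by cases linarith+
        then show ?thesis using dd by simp
      next
        \<comment> \<open>Together with d' \<le> n - \<omega> this gives 2\<omega> \<le> \<omega>' +
          d, where the right side is at most 3(n - 1)/2. The lower bound on \<omega> then turns
          every estimate into an equality.\<close>
        assume "A \<le> \<omega>' + d - n - 1"
        then show ?thesis using 3 \<omega>(3,4) \<omega>4 D unfolding A_def by linarith
      qed
    next
      \<comment> \<open>The overlap bounds give \<omega> - d' + g \<le> b \<le> n - \<omega>' + d -
        g. With both shifts small this yields 4\<omega> + 4 \<le> 3n.\<close>
      case 4
      then show ?thesis using ov g \<omega> \<omega>4 lt D by linarith
    qed
    then show "2 * d = n - 1" "\<omega>' = n - 1" "d' = n - \<omega>" "4 * \<omega> = 3 * n - 3" by auto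
  qed
  define k where "k = n - 1 - \<omega>"
  have k: "n = 4 * k + 1" "\<omega> = 3 * k" "\<omega>' = 4 * k" "d = 2 * k" "d' = k + 1"
  proof -
    show *: "n = 4 * k + 1" "\<omega> = 3 * k" using cases(4) k_def by presburger+
    show "\<omega>' = 4 * k" "d = 2 * k" "d' = k + 1" using cases(1-3) * by simp_all
  qed
  have k2: "2 \<le> k" using dd k d by auto
  \<comment> \<open>Here \<open>A = 2 * k - 2\<close> and \<open>B = 2 * k - 1\<close>, so
    \<open>sep\<close> leaves three starts. In the outer two cases \<open>x\<close> would vanish at
    \<open>n - 1\<close> or at \<open>A\<close>, since \<open>w\<close> is zero at both positions
    involved.\<close>
  have "b \<in> {2 * k - 1, 2 * k, 2 * k + 1}" using sep k unfolding A_def B_def by auto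
  then consider "b = 2 * k - 1" | "b = 2 * k" | "b = 2 * k + 1" by blast
  then show False
  proof cases
    case 1
    have "\<not> w (4 * k)" "\<not> w (2 * k - 1)" by (rule w0; use 1 k k2 in linarith)+
    then show False using xn1 xw[of "4 * k"] wn[of "2 * k - 1"] k by (auto simp: algebra_simps)
  next
    \<comment> \<open>The one of \<open>x\<close> at \<open>b - 1\<close> forces
      \<open>v (3 * k)\<close> and with it \<open>x (3 * k)\<close>, whereas \<open>w\<close>
      vanishes at \<open>3 * k\<close> and \<open>5 * k\<close>.\<close>
    case 2
    have "x (2 * k - 1)" using xB1 2 by simp
    then have "v (3 * k)" using v0[of "2 * k - 1"] k k2 unfolding x_def by (auto simp: algebra_simps)
    moreover have "\<not> v (3 * k + d')" using vn[of 0] v0[of 0] k k2 by (auto simp: algebra_simps)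
    ultimately have "x (3 * k)" unfolding x_def by simp
    moreover have "\<not> w (3 * k)" "\<not> w (5 * k)" by (rule w0; use 2 k k2 in linarith)+
    ultimately show False using xw[of "3 * k"] k by simp
  next
    case 3
    have "\<not> w (4 * k - 2)" "\<not> w (6 * k - 1)" by (rule w0; use 3 k k2 in linarith)+
    then show False
      using xA1(2) xw[of A] wn[of "2 * k - 2"] k by (simp add: A_def algebra_simps)
  qed
qed


section \<open>Shift registers and words with two successors\<close>

text \<open>A window of \<open>\<omega> + d - 1\<close> terms encodes \<open>\<omega> - 1\<close>
  agreements at shift \<open>d\<close>; the two inequalities forbid prolonging them on either
  side.\<close>

definition maximal_run :: "(int \<Rightarrow> bool) \<Rightarrow> int \<Rightarrow> int \<Rightarrow> int \<Rightarrow> bool" where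
  "maximal_run U \<omega> a d \<longleftrightarrow> per U a (a + \<omega> + d - 1) d
     \<and> U (a - 1 + d) \<noteq> U (a - 1) \<and> U (a + \<omega> - 1 + d) \<noteq> U (a + \<omega> - 1)"

text \<open>Only divisors of \<open>d\<close> compete, matching the notion of an aperiodic block of
  length \<open>d\<close>.\<close>

definition primitive_period :: "(int \<Rightarrow> bool) \<Rightarrow> int \<Rightarrow> int \<Rightarrow> int \<Rightarrow> bool" where
  "primitive_period U a b d \<longleftrightarrow> (\<forall>e. 0 < e \<and> e dvd d \<and> per U a b e \<longrightarrow> e = d)"

text \<open>The obstruction to a register of length \<open>L\<close>: a word of that length with two
  different successors.\<close>

definition ambiguous :: "(nat \<Rightarrow> bool) \<Rightarrow> nat \<Rightarrow> bool" where
  "ambiguous u L \<longleftrightarrow> (\<exists>i j. (\<forall>k<L. u (i + k) = u (j + k)) \<and> u (i + L) \<noteq> u (j + L))"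

lemma register_iff_not_ambiguous:
  "(\<exists>f :: bool list \<Rightarrow> bool. \<forall>i. u (i + L) = f (map (\<lambda>j. u (i + j)) [0..<L]))
    \<longleftrightarrow> \<not> ambiguous u L" (is "?register \<longleftrightarrow> _")
proof
  assume ?register
  then obtain f :: "bool list \<Rightarrow> bool" where f: "u (i + L) = f (map (\<lambda>j. u (i + j)) [0..<L])" for i
    by blast
  show "\<not> ambiguous u L"
  proof
    assume "ambiguous u L"
    then obtain i j where ij: "\<forall>k<L. u (i + k) = u (j + k)" "u (i + L) \<noteq> u (j + L)"
      unfolding ambiguous_def by blast
    then have "map (\<lambda>k. u (i + k)) [0..<L] = map (\<lambda>k. u (j + k)) [0..<L]" by simp
    then show False using f[of i] f[of j] ij(2) by metis
  qed
next
  assume na: "\<not> ambiguous u L"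
  \<comment> \<open>Words that never occur in \<open>u\<close> get the value false.\<close>
  define f where "f xs \<longleftrightarrow> (\<exists>i. map (\<lambda>j. u (i + j)) [0..<L] = xs \<and> u (i + L))" for xs
  have "u (i + L) = f (map (\<lambda>j. u (i + j)) [0..<L])" for i
  proof
    assume "f (map (\<lambda>j. u (i + j)) [0..<L])"
    then obtain i' where "map (\<lambda>j. u (i' + j)) [0..<L] = map (\<lambda>j. u (i + j)) [0..<L]" "u (i' + L)"
      unfolding f_def by blast
    then have "\<forall>k<L. u (i' + k) = u (i + k)" "u (i' + L)" by (auto simp: map_eq_conv)
    then show "u (i + L)" using na unfolding ambiguous_def by blast
  qed (auto simp: f_def)
  then show ?register by blast
qed

text \<open>Dropping the first \<open>L - L'\<close> terms of both occurrences keeps the mismatch at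
  the end.\<close>

lemma ambiguous_antimono:
  assumes "ambiguous u L" "L' \<le> L"
  shows "ambiguous u L'"
proof -
  from assms(1) obtain i j where "\<forall>k<L. u (i + k) = u (j + k)" "u (i + L) \<noteq> u (j + L)"
    unfolding ambiguous_def by blast
  moreover have "L - L' + k < L" if "k < L'" for k using that assms(2) by simp
  ultimately have "u (i + (L - L' + k)) = u (j + (L - L' + k))" if "k < L'" for k
    using that by blast
  then have "\<forall>k<L'. u (i + (L - L') + k) = u (j + (L - L') + k)" by (simp only: add.assoc) simp
  moreover have "u (i + (L - L') + L') \<noteq> u (j + (L - L') + L')"
    using assms(2) \<open>u (i + L) \<noteq> u (j + L)\<close> by simp
  ultimately show ?thesis unfolding ambiguous_def by blast
qed

text \<open>The second hypothesis ensures that the \<open>LEAST\<close> is attained. By antitonicity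
  the complexity is the threshold at which ambiguity stops.\<close>

lemma nlc_eq_iff_ambiguous:
  assumes "0 < \<omega>" "\<not> ambiguous u L"
  shows "nlc u = \<omega> \<longleftrightarrow> ambiguous u (\<omega> - 1) \<and> \<not> ambiguous u \<omega>"
proof -
  have nlc: "nlc u = (LEAST L. \<not> ambiguous u L)"
    unfolding nlc_def register_iff_not_ambiguous ..
  show ?thesis
  proof
    assume "nlc u = \<omega>"
    then have "\<not> ambiguous u \<omega>" "\<And>L. L < \<omega> \<Longrightarrow> ambiguous u L"
      using LeastI[of "\<lambda>L. \<not> ambiguous u L", OF assms(2)] not_less_Least[of _ "\<lambda>L. \<not> ambiguous u L"]
      unfolding nlc by blast+
    then show "ambiguous u (\<omega> - 1) \<and> \<not> ambiguous u \<omega>" using assms(1) by simp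
  next
    assume a: "ambiguous u (\<omega> - 1) \<and> \<not> ambiguous u \<omega>"
    then have "\<omega> \<le> L" if "\<not> ambiguous u L" for L
      using ambiguous_antimono[of u "\<omega> - 1" L] that by linarith
    then show "nlc u = \<omega>" unfolding nlc using a by (intro Least_equality) auto
  qed
qed

text \<open>The two-sided extension allows matches to be followed to the left of index 0.\<close>

definition ext :: "(nat \<Rightarrow> bool) \<Rightarrow> nat \<Rightarrow> int \<Rightarrow> bool" where
  "ext u n i = u (nat (i mod int n))"

lemma ext_add_period: "ext u n (i + int n) = ext u n i"
  unfolding ext_def by simp

lemma ext_cong: "i mod int n = j mod int n \<Longrightarrow> ext u n i = ext u n j"
  unfolding ext_def by simp

lemma ext_int:
  assumes "\<And>i. u (i + n) = u i"
  shows "ext u n (int i) = u i"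
proof -
  have "u (j + m * n) = u j" for j m
    by (induction m) (simp_all add: assms add.assoc[symmetric] add.commute[of n])
  from this[of "i mod n" "i div n"] show ?thesis
    unfolding ext_def by (simp add: nat_mod_as_int[symmetric] zmod_int[symmetric])
qed

text \<open>Occurrences at distance \<open>e\<close> modulo \<open>n\<close> are at distance
  \<open>n - e\<close> when their order is swapped, so one of the two shifts is at most half the
  period.\<close>

lemma ambiguous_iff_ext:
  assumes u: "\<And>i. u (i + n) = u i" and n: "0 < n"
  shows "ambiguous u L \<longleftrightarrow> (\<exists>a d. 0 < d \<and> 2 * d \<le> int n \<and> per (ext u n) a (a + int L + d) d
           \<and> ext u n (a + int L + d) \<noteq> ext u n (a + int L))"
proof
  assume "ambiguous u L"
  then obtain i j where ij: "\<And>k. k < L \<Longrightarrow> u (i + k) = u (j + k)" "u (i + L) \<noteq> u (j + L)"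
    unfolding ambiguous_def by blast
  define U where "U = ext u n"
  define e where "e = (int j - int i) mod int n"
  have e: "0 \<le> e" "e < int n" using n by (auto simp: e_def)
  have Ui: "U (int i + int k) = u (i + k)" for k
    using ext_int[where u=u, OF u, of "i + k"] by (simp add: U_def)
  have Uj: "U (int i + e + int k) = u (j + k)" for k
  proof -
    have "(int i + e + int k) mod int n = (int j + int k) mod int n"
      unfolding e_def by (metis (no_types, opaque_lifting) add.commute diff_add_cancel mod_add_left_eq)
    then have "U (int i + e + int k) = U (int (j + k))" unfolding U_def by (intro ext_cong) simp
    then show ?thesis using ext_int[where u=u, OF u, of "j + k"] by (simp add: U_def)
  qed
  have "e \<noteq> 0" using Ui[of L] Uj[of L] ij by auto
  show "\<exists>a d. 0 < d \<and> 2 * d \<le> int n \<and> per (ext u n) a (a + int L + d) d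
           \<and> ext u n (a + int L + d) \<noteq> ext u n (a + int L)"
  proof (cases "2 * e \<le> int n")
    case True
    have "per U (int i) (int i + int L + e) e"
      unfolding per_def
    proof (intro allI impI, elim conjE)
      fix x assume "int i \<le> x" "x + e < int i + int L + e"
      then show "U (x + e) = U x"
        using Ui[of "nat (x - int i)"] Uj[of "nat (x - int i)"] ij(1)[of "nat (x - int i)"]
        by (simp add: algebra_simps)
    qed
    moreover have "U (int i + int L + e) \<noteq> U (int i + int L)"
      using Ui[of L] Uj[of L] ij by (simp add: algebra_simps)
    ultimately show ?thesis using True e \<open>e \<noteq> 0\<close> unfolding U_def by (intro exI conjI) auto
  next
    case False
    have s: "U (x + (int n - e)) = U (x - e)" for x
      using ext_add_period[of u n "x - e"] by (simp add: U_def algebra_simps)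
    have "per U (int i + e) (int i + e + int L + (int n - e)) (int n - e)"
      unfolding per_def
    proof (intro allI impI, elim conjE)
      fix x assume "int i + e \<le> x" "x + (int n - e) < int i + e + int L + (int n - e)"
      then show "U (x + (int n - e)) = U x"
        using Ui[of "nat (x - int i - e)"] Uj[of "nat (x - int i - e)"] ij(1)[of "nat (x - int i - e)"]
        unfolding s by (simp add: algebra_simps)
    qed
    moreover have "U (int i + e + int L + (int n - e)) \<noteq> U (int i + e + int L)"
      using Ui[of L] Uj[of L] ij unfolding s by (simp add: algebra_simps)
    ultimately show ?thesis using False e \<open>e \<noteq> 0\<close> unfolding U_def
      by (intro exI[of _ "int i + e"] exI[of _ "int n - e"] conjI) auto
  qed
next
  assume "\<exists>a d. 0 < d \<and> 2 * d \<le> int n \<and> per (ext u n) a (a + int L + d) d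
           \<and> ext u n (a + int L + d) \<noteq> ext u n (a + int L)"
  then obtain a d where ad: "per (ext u n) a (a + int L + d) d"
    "ext u n (a + int L + d) \<noteq> ext u n (a + int L)" by blast
  define i j where "i = nat (a mod int n)" and "j = nat ((a + d) mod int n)"
  have "u (nat (x mod int n) + k) = ext u n (x + int k)" for x k
  proof -
    have "u (nat (x mod int n) + k) = ext u n (int (nat (x mod int n) + k))"
      using ext_int[where u=u, OF u, of "nat (x mod int n) + k"] by (rule sym)
    also have "\<dots> = ext u n (x + int k)" using n by (intro ext_cong) (simp add: mod_simps)
    finally show ?thesis .
  qed
  then have "u (i + k) = ext u n (a + int k)" "u (j + k) = ext u n (a + int k + d)" for k
    unfolding i_def j_def by (simp_all add: algebra_simps)
  then have "\<forall>k<L. u (i + k) = u (j + k)" "u (i + L) \<noteq> u (j + L)"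
    using ad perD[OF ad(1)] by auto
  then show "ambiguous u L" unfolding ambiguous_def by blast
qed

text \<open>Follow \<open>p\<close> under repeated addition of \<open>d\<close> modulo
  \<open>n\<close>. Every step except the first keeps the value and the orbit returns to
  \<open>p\<close>, so the first step keeps it as well.\<close>

lemma no_single_mismatch:
  fixes U :: "int \<Rightarrow> bool" and n d p :: int
  assumes nper: "\<And>i. U (i + n) = U i" and n: "0 < n"
    and eq: "\<And>i. p - n < i \<Longrightarrow> i < p \<Longrightarrow> U (i + d) = U i"
  shows "U (p + d) = U p"
proof -
  have cong: "U i = U j" if "n dvd j - i" for i j
  proof -
    have "per U (min i j) (max i j + 1) n" unfolding per_def using nper by simp
    then show ?thesis by (rule per_cong[OF _ n _ _ _ _ that]) auto
  qed
  have step: "U (i + d) = U i" if "\<not> n dvd i - p" for i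
  proof -
    define m where "m = (i - p) mod n"
    have m: "0 < m" "m < n" "n dvd (i - p) - m"
      using n that pos_mod_sign[of n "i - p"] pos_mod_bound[of n "i - p"] dvd_minus_mod[of n "i - p"]
      unfolding m_def dvd_eq_mod_eq_0 by linarith+
    have "U (p - n + m + d) = U (p - n + m)" using m by (intro eq) auto
    moreover have "n dvd i - (p - n + m)" using dvd_add[OF m(3) dvd_refl] by (simp add: algebra_simps)
    ultimately show ?thesis using cong[of i "p - n + m"] cong[of "i + d" "p - n + m + d"]
      by (simp add: algebra_simps)
  qed
  \<comment> \<open>\<open>J\<close> is the order of \<open>d\<close> modulo \<open>n\<close>; by
    minimality the orbit avoids \<open>p\<close> before its return.\<close>
  define J where "J = (LEAST j. 0 < j \<and> n dvd int j * d)"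
  have "0 < nat n \<and> n dvd int (nat n) * d" using n by simp
  then have J: "0 < J" "n dvd int J * d" unfolding J_def by (metis (mono_tags, lifting) LeastI)+
  have less: "\<not> n dvd int j * d" if "0 < j" "j < J" for j
    using not_less_Least[of j "\<lambda>j. 0 < j \<and> n dvd int j * d"] that unfolding J_def by blast
  have "U (p + int (Suc j) * d) = U (p + d)" if "Suc j \<le> J" for j
    using that
  proof (induction j)
    case (Suc j)
    have "U (p + int (Suc j) * d + d) = U (p + int (Suc j) * d)"
      using less[of "Suc j"] Suc.prems by (intro step) auto
    then show ?case using Suc by (simp add: algebra_simps)
  qed simp
  from this[of "J - 1"] J(1) have "U (p + int J * d) = U (p + d)" by simp
  moreover have "U (p + int J * d) = U p" using J(2) by (intro cong) auto
  ultimately show ?thesis by simp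
qed

lemma not_ambiguous_period:
  assumes u: "\<And>i. u (i + n) = u i" and n: "0 < n"
  shows "\<not> ambiguous u (n - 1)"
proof
  assume "ambiguous u (n - 1)"
  then obtain a d where ad: "per (ext u n) a (a + int (n - 1) + d) d"
    "ext u n (a + int (n - 1) + d) \<noteq> ext u n (a + int (n - 1))"
    unfolding ambiguous_iff_ext[where u = u, OF u n] by blast
  have "ext u n (a + int (n - 1) + d) = ext u n (a + int (n - 1))"
  proof (rule no_single_mismatch[where n = "int n"])
    fix i assume "a + int (n - 1) - int n < i" "i < a + int (n - 1)"
    then show "ext u n (i + d) = ext u n i" using n by (intro perD[OF ad(1)]) auto
  next
    show "ext u n (i + int n) = ext u n i" for i by (rule ext_add_period)
  qed (use n in simp)
  then show False using ad(2) by simp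
qed


section \<open>Complexity as the existence of a primitive maximal run\<close>

text \<open>A match of length \<open>\<omega>\<close>, prolonged to the left as far as possible,
  would be a second maximal match longer than the given one.\<close>

lemma maximal_run_not_ambiguous:
  assumes u: "\<And>i. u (i + n) = u i" and n: "0 < n"
    and d: "0 < d" "2 * d \<le> int n" and \<omega>: "0 < \<omega>" "3 * n div 4 \<le> \<omega>"
    and run: "maximal_run (ext u n) (int \<omega>) a d"
    and prim: "primitive_period (ext u n) a (a + int \<omega> + d - 1) d"
  shows "\<not> ambiguous u \<omega>"
proof
  define U where "U = ext u n"
  have nper: "U (i + int n) = U i" for i unfolding U_def by (rule ext_add_period)
  assume "ambiguous u \<omega>"
  then obtain c d' where d': "0 < d'" "2 * d' \<le> int n" and c: "per U c (c + int \<omega> + d') d'"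
    "U (c + int \<omega> + d') \<noteq> U (c + int \<omega>)"
    unfolding ambiguous_iff_ext[where u = u, OF u n] U_def by blast
  define p where "p = c + int \<omega>"
  \<comment> \<open>\<open>Q l\<close> says that the \<open>l\<close> positions before the mismatch
    \<open>p\<close> agree. The greatest such \<open>l\<close> exists because \<open>n - 1\<close>
    agreements exclude a mismatch at \<open>p\<close>.\<close>
  define Q where "Q l \<longleftrightarrow> per U (p - int l) (p + d') d'" for l
  have Q\<omega>: "Q \<omega>" using c(1) by (simp add: Q_def p_def)
  have bound: "l \<le> n - 2" if "Q l" for l
  proof (rule ccontr)
    assume "\<not> l \<le> n - 2"
    then have "per U (p - int (n - 1)) (p - int (n - 1) + int (n - 1) + d') d'"
      using that n unfolding Q_def by (elim per_mono) auto
    moreover have "U (p - int (n - 1) + int (n - 1) + d') \<noteq> U (p - int (n - 1) + int (n - 1))"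
      using c(2) unfolding p_def by simp
    ultimately have "ambiguous u (n - 1)"
      unfolding ambiguous_iff_ext[where u = u, OF u n] U_def using d' by blast
    then show False using not_ambiguous_period[where u = u, OF u n] by blast
  qed
  define l where "l = (GREATEST l. Q l)"
  have "Q l" and greatest: "\<And>m. Q m \<Longrightarrow> m \<le> l"
    unfolding l_def using GreatestI_nat[where P = Q, OF Q\<omega> bound] Greatest_le_nat[where P = Q, OF _ bound]
    by blast+
  have l: "\<omega> \<le> l" "l \<le> n - 2" using greatest[OF Q\<omega>] bound[OF \<open>Q l\<close>] by auto
  have left: "U (p - int l - 1 + d') \<noteq> U (p - int l - 1)"
  proof
    assume eq: "U (p - int l - 1 + d') = U (p - int l - 1)"
    have "Q (Suc l)" unfolding Q_def per_def
    proof (intro allI impI, elim conjE)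
      fix i assume i: "p - int (Suc l) \<le> i" "i + d' < p + d'"
      show "U (i + d') = U i"
      proof (cases "i = p - int l - 1")
        case False
        then show ?thesis using i by (intro perD[OF \<open>Q l\<close>[unfolded Q_def]]) auto
      qed (simp add: eq)
    qed
    then show False using greatest by fastforce
  qed
  have n2: "2 \<le> n" using d by linarith
  \<comment> \<open>The origin moves to \<open>a\<close>, and the start of the second match is
    reduced modulo \<open>n\<close>.\<close>
  define U' where "U' i = U (a + i)" for i
  define b where "b = (p - int l - a) mod int n"
  have b: "0 \<le> b" "b < int n" using n by (auto simp: b_def)
  have U'b: "U' (b + i) = U (p - int l + i)" for i
  proof -
    have "(b + (a + i)) mod int n = (p - int l - a + (a + i)) mod int n"
      unfolding b_def by (rule mod_add_left_eq)
    then show ?thesis unfolding U'_def U_def by (intro ext_cong) (simp add: algebra_simps)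
  qed
  have run2: "U' (i + d') = U' i" if "b \<le> i" "i < b + int (Suc l) - 1" for i
  proof -
    have "U (p - int l + (i - b) + d') = U (p - int l + (i - b))"
      using that \<open>Q l\<close> unfolding Q_def by (intro perD) auto
    then show ?thesis using U'b[of "i - b"] U'b[of "i - b + d'"] by (simp add: algebra_simps)
  qed
  have run1: "U' (i + d) = U' i" if "0 \<le> i" "i < int \<omega> - 1" for i
    using run that perD[of U a "a + int \<omega> + d - 1" d "a + i"]
    unfolding U'_def maximal_run_def U_def by (simp add: algebra_simps)
  have prim': "e = d" if "0 < e" "e dvd d" "per U' 0 (int \<omega> + d - 1) e" for e
  proof -
    have "per U a (a + int \<omega> + d - 1) e"
      unfolding per_def
    proof (intro allI impI, elim conjE)
      fix i assume "a \<le> i" "i + e < a + int \<omega> + d - 1"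
      then show "U (i + e) = U i" using perD[OF that(3), of "i - a"] unfolding U'_def
        by (simp add: algebra_simps)
    qed
    then show ?thesis using prim that unfolding primitive_period_def U_def by blast
  qed
  show False
  proof (rule maximal_runs_conflict[of U' "int n" d d' "int \<omega>" "int (Suc l)" b])
    show "U' (i + int n) = U' i" for i using nper[of "a + i"] by (simp add: U'_def algebra_simps)
    show "U' (- 1 + d) \<noteq> U' (- 1)" "U' (int \<omega> - 1 + d) \<noteq> U' (int \<omega> - 1)"
      using run unfolding maximal_run_def U'_def U_def by (simp_all add: algebra_simps)
    show "U' (b - 1 + d') \<noteq> U' (b - 1)"
      using U'b[of "- 1"] U'b[of "- 1 + d'"] left by (simp add: algebra_simps)
    show "U' (b + int (Suc l) - 1 + d') \<noteq> U' (b + int (Suc l) - 1)"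
      using U'b[of "int l"] U'b[of "int l + d'"] c(2) by (simp add: p_def algebra_simps)
    show "3 * int n div 4 \<le> int \<omega>" using \<omega>(2) by linarith
    show "int \<omega> < int (Suc l)" "int (Suc l) \<le> int n - 1" "0 < int \<omega>" using \<omega>(1) l n2 by linarith+
  qed (fact d d' b | erule (1) run1 run2 | erule (2) prim')+
qed

text \<open>From left to right, a match of length \<open>\<omega> - 1\<close> is taken: an agreement
  on its left or a smaller period of its window would each produce a match of length
  \<open>\<omega>\<close>. The converse rests on the exclusion of longer matches.\<close>

lemma nlc_eq_iff_maximal_run:
  assumes u: "\<And>i. u (i + n) = u i" and n: "0 < n" and \<omega>: "0 < \<omega>" "3 * n div 4 \<le> \<omega>"
  shows "nlc u = \<omega> \<longleftrightarrow> (\<exists>a d. 0 < d \<and> 2 * d \<le> int n \<and> maximal_run (ext u n) (int \<omega>) a d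
           \<and> primitive_period (ext u n) a (a + int \<omega> + d - 1) d)"
    (is "_ \<longleftrightarrow> ?rhs")
proof -
  define U where "U = ext u n"
  have amb: "ambiguous u L \<longleftrightarrow> (\<exists>a d. 0 < d \<and> 2 * d \<le> int n \<and> per U a (a + int L + d) d
           \<and> U (a + int L + d) \<noteq> U (a + int L))" for L
    unfolding U_def by (rule ambiguous_iff_ext[where u = u, OF u n])
  have nlc: "nlc u = \<omega> \<longleftrightarrow> ambiguous u (\<omega> - 1) \<and> \<not> ambiguous u \<omega>"
    by (rule nlc_eq_iff_ambiguous[OF \<omega>(1) not_ambiguous_period[where u = u, OF u n]])
  have w1: "int (\<omega> - 1) = int \<omega> - 1" using \<omega>(1) by simp
  show ?thesis
  proof
    assume "nlc u = \<omega>"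
    then have am: "ambiguous u (\<omega> - 1)" "\<not> ambiguous u \<omega>" using nlc by auto
    then obtain a d where d: "0 < d" "2 * d \<le> int n"
      and p: "per U a (a + (int \<omega> - 1) + d) d" and ne: "U (a + (int \<omega> - 1) + d) \<noteq> U (a + (int \<omega> - 1))"
      unfolding amb w1 by blast
    have "U (a - 1 + d) \<noteq> U (a - 1)"
    proof
      assume eq: "U (a - 1 + d) = U (a - 1)"
      have "per U (a - 1) (a - 1 + int \<omega> + d) d"
        unfolding per_def
      proof (intro allI impI, elim conjE)
        fix i assume i: "a - 1 \<le> i" "i + d < a - 1 + int \<omega> + d"
        show "U (i + d) = U i"
        proof (cases "i = a - 1")
          case False
          then show ?thesis using i by (intro perD[OF p]) auto
        qed (simp add: eq)
      qed
      moreover have "U (a - 1 + int \<omega> + d) \<noteq> U (a - 1 + int \<omega>)"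
        using ne by (simp add: algebra_simps)
      ultimately show False using am(2) d unfolding amb by blast
    qed
    then have "maximal_run U (int \<omega>) a d"
      using p ne unfolding maximal_run_def by (simp add: algebra_simps)
    moreover have "primitive_period U a (a + int \<omega> + d - 1) d"
      unfolding primitive_period_def
    proof (intro allI impI, elim conjE)
      fix e assume e: "0 < e" "e dvd d" "per U a (a + int \<omega> + d - 1) e"
      show "e = d"
      proof (rule ccontr)
        assume "e \<noteq> d"
        then have ed: "e < d" using e d zdvd_imp_le[of e d] by simp
        have "U (a + int \<omega> - 1 + d - e) = U (a + int \<omega> - 1)"
          using e d ed \<omega>(1) by (intro per_cong[OF e(3,1)]) (auto simp: dvd_diff)
        then have "U (a + (d - e - 1) + int \<omega> + e) \<noteq> U (a + (d - e - 1) + int \<omega>)"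
          using ne by (simp add: algebra_simps)
        moreover have "per U (a + (d - e - 1)) (a + (d - e - 1) + int \<omega> + e) e"
          using ed by (intro per_mono[OF e(3)]) auto
        ultimately have "ambiguous u \<omega>" unfolding amb using e ed d
          by (intro exI[of _ "a + (d - e - 1)"] exI[of _ e]) auto
        then show False using am by blast
      qed
    qed
    ultimately show ?rhs using d unfolding U_def by blast
  next
    assume ?rhs
    then obtain a d where d: "0 < d" "2 * d \<le> int n" and run: "maximal_run U (int \<omega>) a d"
      and prim: "primitive_period U a (a + int \<omega> + d - 1) d" unfolding U_def by blast
    have "\<not> ambiguous u \<omega>"
      using maximal_run_not_ambiguous[where u = u, OF u n d \<omega>] run prim unfolding U_def by blast
    moreover have "ambiguous u (\<omega> - 1)"
      unfolding amb w1 using d run unfolding maximal_run_def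
      by (intro exI[of _ a] exI[of _ d]) (simp add: algebra_simps)
    ultimately show "nlc u = \<omega>" using nlc by blast
  qed
qed

section \<open>The block forms as periodic windows\<close>

lemma mod_periodic_iff:
  fixes s :: "nat \<Rightarrow> bool"
  assumes "0 < d"
  shows "(\<forall>j<N. s j = s (j mod d)) \<longleftrightarrow> (\<forall>j. j + d < N \<longrightarrow> s (j + d) = s j)"
proof
  assume mod: "\<forall>j<N. s j = s (j mod d)"
  show "\<forall>j. j + d < N \<longrightarrow> s (j + d) = s j"
  proof (intro allI impI)
    fix j assume "j + d < N"
    then show "s (j + d) = s j" using mod[rule_format, of j] mod[rule_format, of "j + d"] by simp
  qed
next
  assume step: "\<forall>j. j + d < N \<longrightarrow> s (j + d) = s j"
  have "s j = s (j mod d)" if "j < N" for j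
    using that
  proof (induction j rule: less_induct)
    case (less j)
    show ?case
    proof (cases "j < d")
      case False
      have "s j = s (j - d)" using step[rule_format, of "j - d"] less.prems False by simp
      moreover have "s (j - d) = s ((j - d) mod d)" using False less.prems assms by (intro less.IH) auto
      moreover have "(j - d) mod d = j mod d" using False by (intro le_mod_geq[symmetric]) simp
      ultimately show ?thesis by (simp only:)
    qed simp
  qed
  then show "\<forall>j<N. s j = s (j mod d)" by blast
qed

text \<open>Full copies followed by a partial one are a window of period \<open>d\<close>. Since
  \<open>N - d\<close> is congruent to \<open>r\<close> modulo \<open>d\<close>, complementing
  \<open>s r\<close> is a mismatch with the term \<open>d\<close> places earlier.\<close>

lemma broken_repetition_iff:
  fixes s :: "nat \<Rightarrow> bool"
  assumes "0 < d" "d \<le> N" and q: "q = N div d" and r: "r = N - q * d"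
  shows "(\<forall>j<q * d. s j = s (j mod d)) \<and> (\<forall>j<r. s (q * d + j) = s j) \<and> s (q * d + r) = (\<not> s r)
    \<longleftrightarrow> (\<forall>j. j + d < N \<longrightarrow> s (j + d) = s j) \<and> s N \<noteq> s (N - d)" (is "?blocks \<longleftrightarrow> ?shift")
proof -
  have N: "q * d + r = N" "r = N mod d" "r < d"
    using assms by (auto simp: minus_div_mult_eq_mod)
  have "(\<forall>j<q * d. s j = s (j mod d)) \<and> (\<forall>j<r. s (q * d + j) = s j) \<longleftrightarrow> (\<forall>j<N. s j = s (j mod d))"
    (is "?l \<longleftrightarrow> ?r")
  proof
    assume l: ?l
    show ?r
    proof (intro allI impI)
      fix j assume "j < N"
      show "s j = s (j mod d)"
      proof (cases "j < q * d")
        case False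
        then obtain i where i: "j = q * d + i" using le_Suc_ex not_less by blast
        then have "i < r" using \<open>j < N\<close> N by simp
        then show ?thesis using l i N by simp
      qed (use l in blast)
    qed
  next
    assume r: ?r
    show ?l
    proof (intro conjI allI impI)
      show "s j = s (j mod d)" if "j < q * d" for j
        using that N by (intro r[rule_format]) simp
      show "s (q * d + j) = s j" if "j < r" for j
        using r[rule_format, of "q * d + j"] N that by simp
    qed
  qed
  moreover have "s r = s (N - d)" if "\<forall>j. j + d < N \<longrightarrow> s (j + d) = s j"
  proof -
    have "s (N - d) = s ((N - d) mod d)"
      using that[folded mod_periodic_iff[OF assms(1)]] assms(1,2) by (meson diff_less order_less_le_trans)
    then show ?thesis using N assms by (simp add: le_mod_geq)
  qed
  ultimately show ?thesis unfolding mod_periodic_iff[OF assms(1)] N(1) by blast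
qed

lemma per_int_iff:
  assumes U: "\<And>i. U (int k + int i) = s i"
  shows "per U (int k) (int k + int N) (int e) \<longleftrightarrow> (\<forall>j. j + e < N \<longrightarrow> s (j + e) = s j)"
proof
  assume s: "\<forall>j. j + e < N \<longrightarrow> s (j + e) = s j"
  show "per U (int k) (int k + int N) (int e)" unfolding per_def
  proof (intro allI impI, elim conjE)
    fix i assume "int k \<le> i" "i + int e < int k + int N"
    then show "U (i + int e) = U i"
      using s[rule_format, of "nat (i - int k)"] U[of "nat (i - int k)"] U[of "nat (i - int k) + e"]
      by (simp add: algebra_simps)
  qed
next
  assume p: "per U (int k) (int k + int N) (int e)"
  show "\<forall>j. j + e < N \<longrightarrow> s (j + e) = s j"
  proof (intro allI impI)
    fix j assume "j + e < N"
    then have "U (int k + int j + int e) = U (int k + int j)" by (intro perD[OF p]) auto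
    then show "s (j + e) = s j" using U[of j] U[of "j + e"] by (simp add: add.assoc)
  qed
qed

lemma aperiodic_iff_primitive_period:
  assumes U: "\<And>i. U (int k + int i) = s i" and "0 < d"
  shows "aperiodic d s \<longleftrightarrow> primitive_period U (int k) (int k + int d) (int d)"
proof -
  have iff: "(\<forall>j<d. s j = s (j mod e)) \<longleftrightarrow> per U (int k) (int k + int d) (int e)" if "0 < e" for e
    unfolding mod_periodic_iff[OF that] per_int_iff[where U = U and s = s, OF U] ..
  show ?thesis
  proof
    assume a: "aperiodic d s"
    show "primitive_period U (int k) (int k + int d) (int d)"
      unfolding primitive_period_def
    proof (intro allI impI, elim conjE)
      fix e assume e: "0 < e" "e dvd int d" "per U (int k) (int k + int d) e"
      define e' where "e' = nat e"
      have e': "e = int e'" "0 < e'" using e by (auto simp: e'_def)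
      have "e' dvd d" "e' \<le> d" using e e' assms(2) by (auto simp: dvd_imp_le)
      moreover have "\<forall>j<d. s j = s (j mod e')" 
        using e(3)[unfolded e'(1)] iff[OF e'(2)] by blast
      ultimately have "\<not> e' < d" using a unfolding aperiodic_def by blast
      then show "e = int d" using e' \<open>e' \<le> d\<close> by simp
    qed
  next
    assume p: "primitive_period U (int k) (int k + int d) (int d)"
    show "aperiodic d s" unfolding aperiodic_def
    proof (intro notI, elim exE conjE)
      fix e assume e: "e dvd d" "e < d" "\<forall>j<d. s j = s (j mod e)"
      \<comment> \<open>Zero divides only zero, so the definition of \<open>aperiodic\<close> admits
        no degenerate divisor here.\<close>
      then have "0 < e" using assms(2) by (cases e) auto
      then have "per U (int k) (int k + int d) (int e)" using e(3) iff by blast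
      then have "int e = int d"
        using p[unfolded primitive_period_def, rule_format, of "int e"] e(1) \<open>0 < e\<close> by simp
      then show False using e(2) by simp
    qed
  qed
qed


text \<open>A subwindow of length \<open>d\<close> already determines which divisors of
  \<open>d\<close> are periods. This links the aperiodic first block to the window of the
  run.\<close>

lemma primitive_period_window:
  assumes "per U a b d" "0 < d" "a \<le> a'" "b' \<le> b" "d \<le> b' - a'"
  shows "primitive_period U a' b' d \<longleftrightarrow> primitive_period U a b d"
proof -
  have "per U a' b' e \<longleftrightarrow> per U a b e" if "0 < e" "e dvd d" for e
    using per_extend[OF assms(1) that(1) assms(2) that(2) _ assms(3-5)]
      per_mono[OF _ assms(3,4)] by blast
  then show ?thesis unfolding primitive_period_def by blast
qed

lemma form_i_iff:
  assumes u: "\<And>i. u (i + n) = u i" and "0 < d" "0 < \<omega>" "0 < n"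
  shows "form_i n \<omega> d (\<lambda>j. u (k + j)) \<longleftrightarrow> maximal_run (ext u n) (int \<omega>) (int k) (int d)
    \<and> primitive_period (ext u n) (int k) (int k + int \<omega> + int d - 1) (int d)"
proof -
  define U s where "U = ext u n" and "s j = u (k + j)" for j
  have U: "U (int k + int i) = s i" for i
    using ext_int[where u = u, OF u, of "k + i"] by (simp add: U_def s_def)
  define N where "N = \<omega> + d - 1"
  have N: "d \<le> N" "N - d = \<omega> - 1" "int N = int \<omega> + int d - 1" using assms by (auto simp: N_def)
  have form: "form_i n \<omega> d s \<longleftrightarrow> aperiodic d s \<and> (\<forall>j. j + d < N \<longrightarrow> s (j + d) = s j)
      \<and> s N \<noteq> s (N - d) \<and> s (n - 1) \<noteq> s (d - 1)"
    using broken_repetition_iff[where s = s, OF assms(2) N(1) refl refl]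
    unfolding form_i_def Let_def N_def by blast
  \<comment> \<open>By periodicity the term before the block is its last one, so the prescribed last
    term is the mismatch on the left.\<close>
  have "U (int k - 1) = s (n - 1)"
    using U[of "n - 1"] ext_add_period[of u n "int k - 1"] \<open>0 < n\<close>
    by (simp add: U_def algebra_simps)
  moreover have "U (int k - 1 + int d) = s (d - 1)"
    using U[of "d - 1"] \<open>0 < d\<close> by (simp add: algebra_simps)
  moreover have "U (int k + int \<omega> - 1) = s (N - d)"
    using U[of "N - d"] N \<open>0 < \<omega>\<close> by (simp add: algebra_simps)
  moreover have "U (int k + int \<omega> - 1 + int d) = s N" using U[of N] N by (simp add: algebra_simps)
  moreover have "per U (int k) (int k + int \<omega> + int d - 1) (int d)
      \<longleftrightarrow> (\<forall>j. j + d < N \<longrightarrow> s (j + d) = s j)"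
    using per_int_iff[where U = U and s = s, OF U, of N d] N by (simp add: algebra_simps)
  ultimately have run: "maximal_run U (int \<omega>) (int k) (int d)
      \<longleftrightarrow> (\<forall>j. j + d < N \<longrightarrow> s (j + d) = s j) \<and> s N \<noteq> s (N - d) \<and> s (n - 1) \<noteq> s (d - 1)"
    unfolding maximal_run_def by auto
  have "aperiodic d s \<longleftrightarrow> primitive_period U (int k) (int k + int \<omega> + int d - 1) (int d)"
    if "maximal_run U (int \<omega>) (int k) (int d)"
    unfolding aperiodic_iff_primitive_period[where U = U and s = s, OF U \<open>0 < d\<close>]
    using that assms unfolding maximal_run_def by (intro primitive_period_window) auto
  then show ?thesis using form run unfolding U_def s_def by blast
qed

text \<open>The window has at least \<open>n - 1\<close> terms and starts
  \<open>\<omega> + d - n\<close> places before the block. The conditions on \<open>t\<close> are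
  the agreements to the left of the block and the mismatch that ends them.\<close>

lemma form_ii_iff:
  assumes u: "\<And>i. u (i + n) = u i" and d: "0 < d" "d < n" and \<omega>: "n \<le> \<omega> + d" "\<omega> < n"
  shows "form_ii n \<omega> d (\<lambda>j. u (k + j))
    \<longleftrightarrow> maximal_run (ext u n) (int \<omega>) (int k - int (\<omega> + d - n)) (int d)
      \<and> primitive_period (ext u n) (int k - int (\<omega> + d - n))
          (int k - int (\<omega> + d - n) + int \<omega> + int d - 1) (int d)"
proof -
  define U s where "U = ext u n" and "s j = u (k + j)" for j
  have U: "U (int k + int i) = s i" for i
    using ext_int[where u = u, OF u, of "k + i"] by (simp add: U_def s_def)
  define t where "t = \<omega> + d - n"
  have t: "int t = int \<omega> + int d - int n" "t < d" using \<omega> by (auto simp: t_def)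
  \<comment> \<open>\<open>R\<close> collects the agreements within the block, and \<open>L\<close>
    the \<open>t\<close> agreements before it with the bounding mismatch. For \<open>t = 0\<close>
    only the mismatch remains.\<close>
  define R where "R \<longleftrightarrow> (\<forall>j. j + d < n - 1 \<longrightarrow> s (j + d) = s j)"
  define L where "L \<longleftrightarrow> (\<forall>i. 1 \<le> i \<and> i \<le> t \<longrightarrow> s (n - i) = s (d - i)) \<and> s (n - t - 1) \<noteq> s (d - t - 1)"
  have dn: "d \<le> n - 1" using d by simp
  have form: "form_ii n \<omega> d s \<longleftrightarrow> aperiodic d s \<and> R \<and> s (n - 1) \<noteq> s (n - 1 - d) \<and> L"
  proof -
    define T where "T \<longleftrightarrow> (t = 0 \<longrightarrow> s ((n - 1) mod d) = s (d - 1))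
       \<and> (t > 0 \<longrightarrow>
             (\<not> s ((n - 1) mod d)) = s (d - 1)
             \<and> (\<forall>i. 2 \<le> i \<and> i \<le> t \<longrightarrow> s ((n - i) mod d) = s ((d - i) mod d))
             \<and> s ((n - t - 1) mod d) = (\<not> s ((d - t - 1) mod d)))"
    have "T \<longleftrightarrow> L" if "R" "s (n - 1) \<noteq> s (n - 1 - d)"
    proof -
      have per: "\<forall>j<n - 1. s j = s (j mod d)"
        using that(1) mod_periodic_iff[OF d(1), of "n - 1" s] unfolding R_def by blast
      have "s (n - 1 - d) = s ((n - 1 - d) mod d)"
        using d dn by (intro per[rule_format]) linarith
      also have "(n - 1 - d) mod d = (n - 1) mod d" using dn by (rule le_mod_geq[symmetric])
      \<comment> \<open>The last term breaks the period, so reducing its index modulo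
        \<open>d\<close> complements it. This is why the conditions at \<open>n - 1\<close> look
        reversed; from \<open>i = 2\<close> on, reduction keeps the value.\<close>
      finally have 1: "s ((n - 1) mod d) = (\<not> s (n - 1))" using that(2) by blast
      have 2: "s ((n - i) mod d) = s (n - i)" if "2 \<le> i" for i
        using per[rule_format, of "n - i"] that d by (cases "n \<le> i") auto
      have 3: "s ((d - i) mod d) = s (d - i)" if "0 < i" for i using that d by simp
      have split: "(\<forall>i. 1 \<le> i \<and> i \<le> t \<longrightarrow> P i) \<longleftrightarrow> P 1 \<and> (\<forall>i. 2 \<le> i \<and> i \<le> t \<longrightarrow> P i)"
        if "0 < t" for P
      proof -
        have "1 \<le> i \<and> i \<le> t \<longleftrightarrow> i = 1 \<or> 2 \<le> i \<and> i \<le> t" for i using that by auto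
        then show ?thesis by auto
      qed
      show ?thesis
      proof (cases "t = 0")
        case True
        then show ?thesis unfolding T_def L_def using 1 by auto
      next
        case False
        have "s ((n - t - 1) mod d) = s (n - t - 1)" "s ((d - t - 1) mod d) = s (d - t - 1)"
          using 2[of "t + 1"] 3[of "t + 1"] False by (simp_all add: diff_diff_add)
        moreover have "(\<forall>i. 2 \<le> i \<and> i \<le> t \<longrightarrow> s ((n - i) mod d) = s ((d - i) mod d))
            \<longleftrightarrow> (\<forall>i. 2 \<le> i \<and> i \<le> t \<longrightarrow> s (n - i) = s (d - i))"
        proof -
          have "s ((n - i) mod d) = s ((d - i) mod d) \<longleftrightarrow> s (n - i) = s (d - i)" if "2 \<le> i" for i
            using 2[of i] 3[of i] that by (metis less_le_trans zero_less_numeral)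
          then show ?thesis by blast
        qed
        ultimately show ?thesis
          using False 1 split[of "\<lambda>i. s (n - i) = s (d - i)"] unfolding T_def L_def by auto
      qed
    qed
    moreover have "form_ii n \<omega> d s \<longleftrightarrow> aperiodic d s \<and> (R \<and> s (n - 1) \<noteq> s (n - 1 - d)) \<and> T"
      using broken_repetition_iff[where s = s and N = "n - 1", OF d(1) dn refl refl]
      unfolding form_ii_def Let_def T_def t_def R_def by blast
    ultimately show ?thesis by blast
  qed
  \<comment> \<open>Terms to the left of the block are read off at its end.\<close>
  have U': "U (int k - int i) = s (n - i)" if "i \<le> n" for i
    using U[of "n - i"] ext_add_period[of u n "int k - int i"] that by (simp add: U_def of_nat_diff algebra_simps)
  have Ud: "U (int k - int i + int d) = s (d - i)" if "i \<le> d" for i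
    using U[of "d - i"] that by (simp add: of_nat_diff algebra_simps)
  let ?a = "int k - int t"
  have e: "?a + int \<omega> + int d - 1 = int k + int (n - 1)" using t d by simp
  have per: "per U ?a (int k + int (n - 1)) (int d) \<longleftrightarrow> R \<and> (\<forall>i. 1 \<le> i \<and> i \<le> t \<longrightarrow> s (n - i) = s (d - i))"
  proof
    assume p: "per U ?a (int k + int (n - 1)) (int d)"
    have R using per_mono[OF p, of "int k" "int k + int (n - 1)"]
      per_int_iff[where U = U and s = s, OF U, of "n - 1" d] unfolding R_def by simp
    moreover have "s (n - i) = s (d - i)" if "1 \<le> i" "i \<le> t" for i
      using perD[OF p, of "int k - int i"] U'[of i] Ud[of i] that t d by auto
    ultimately show "R \<and> (\<forall>i. 1 \<le> i \<and> i \<le> t \<longrightarrow> s (n - i) = s (d - i))" by blast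
  next
    assume a: "R \<and> (\<forall>i. 1 \<le> i \<and> i \<le> t \<longrightarrow> s (n - i) = s (d - i))"
    then have p: "per U (int k) (int k + int (n - 1)) (int d)"
      using per_int_iff[where U = U and s = s, OF U, of "n - 1" d] unfolding R_def by simp
    show "per U ?a (int k + int (n - 1)) (int d)"
      unfolding per_def
    proof (intro allI impI, elim conjE)
      fix i assume i: "?a \<le> i" "i + int d < int k + int (n - 1)"
      show "U (i + int d) = U i"
      proof (cases "int k \<le> i")
        case False
        define j where "j = nat (int k - i)"
        have j: "i = int k - int j" "1 \<le> j" "j \<le> t" using False i by (auto simp: j_def)
        then show ?thesis using a U'[of j] Ud[of j] t d by simp
      qed (use i in \<open>intro perD[OF p]\<close>)
    qed
  qed
  have "U (?a - 1) = s (n - t - 1)" "U (?a - 1 + int d) = s (d - t - 1)"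
  proof -
    have "?a - 1 = int k - int (t + 1)" by simp
    then show "U (?a - 1) = s (n - t - 1)" "U (?a - 1 + int d) = s (d - t - 1)"
      using U'[of "t + 1"] Ud[of "t + 1"] \<open>t < d\<close> \<open>d < n\<close> by (simp_all only:) simp_all
  qed
  moreover have "U (?a + int \<omega> - 1 + int d) = s (n - 1)"
  proof -
    have "?a + int \<omega> - 1 + int d = int k + int (n - 1)" using e by linarith
    then show ?thesis by (simp only: U)
  qed
  moreover have "U (?a + int \<omega> - 1) = s (n - 1 - d)"
  proof -
    have "?a + int \<omega> - 1 = int k + int (n - 1 - d)" using t d by linarith
    then show ?thesis by (simp only: U)
  qed
  ultimately have run: "maximal_run U (int \<omega>) ?a (int d) \<longleftrightarrow> R \<and> s (n - 1) \<noteq> s (n - 1 - d) \<and> L"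
    unfolding maximal_run_def e per L_def by auto
  have "aperiodic d s \<longleftrightarrow> primitive_period U ?a (?a + int \<omega> + int d - 1) (int d)"
    if "maximal_run U (int \<omega>) ?a (int d)"
    unfolding aperiodic_iff_primitive_period[where U = U and s = s, OF U \<open>0 < d\<close>] e
    using that d unfolding maximal_run_def e by (intro primitive_period_window) auto
  then show ?thesis using form run unfolding U_def s_def t_def by blast
qed

section \<open>Free choice of the starting index and assembly of the equivalence\<close>

lemma maximal_run_shift:
  assumes "a mod int n = b mod int n"
  shows "maximal_run (ext u n) \<omega> a d \<longleftrightarrow> maximal_run (ext u n) \<omega> b d"
    "primitive_period (ext u n) a (a + l) d \<longleftrightarrow> primitive_period (ext u n) b (b + l) d"
proof -
  have eq: "ext u n (a + x) = ext u n (b + x)" for x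
    using assms by (intro ext_cong) (metis mod_add_left_eq)
  have per: "per (ext u n) a (a + l) e \<longleftrightarrow> per (ext u n) b (b + l) e" for l e
  proof -
    have "per (ext u n) c (c + l) e \<longleftrightarrow> (\<forall>x. 0 \<le> x \<and> x + e < l \<longrightarrow> ext u n (c + (x + e)) = ext u n (c + x))" for c
    proof
      assume p: "per (ext u n) c (c + l) e"
      show "\<forall>x. 0 \<le> x \<and> x + e < l \<longrightarrow> ext u n (c + (x + e)) = ext u n (c + x)"
        using perD[OF p, of "c + x" for x] by (simp add: add.assoc)
    next
      assume x: "\<forall>x. 0 \<le> x \<and> x + e < l \<longrightarrow> ext u n (c + (x + e)) = ext u n (c + x)"
      show "per (ext u n) c (c + l) e" unfolding per_def
      proof (intro allI impI, elim conjE)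
        fix i assume "c \<le> i" "i + e < c + l"
        then show "ext u n (i + e) = ext u n i" using x[rule_format, of "i - c"] by simp
      qed
    qed
    then show ?thesis using eq by simp
  qed
  show "primitive_period (ext u n) a (a + l) d \<longleftrightarrow> primitive_period (ext u n) b (b + l) d"
    unfolding primitive_period_def per ..
  show "maximal_run (ext u n) \<omega> a d \<longleftrightarrow> maximal_run (ext u n) \<omega> b d"
    using per[of "\<omega> + d - 1" d] eq[of "- 1 + d"] eq[of "- 1"] eq[of "\<omega> - 1 + d"] eq[of "\<omega> - 1"]
    unfolding maximal_run_def by (simp add: algebra_simps)
qed

theorem theorem2:
  fixes n \<omega> :: nat and u :: "nat \<Rightarrow> bool"
  assumes "0 < n" and "0 < \<omega>"
    and "3 * n div 4 \<le> \<omega>" and "\<omega> \<le> n - 1"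
    and "least_period u n"
  shows "nlc u = \<omega> \<longleftrightarrow>
    (\<exists>k. (\<exists>d. 1 \<le> d \<and> d \<le> n - \<omega> - 1 \<and> form_i n \<omega> d (\<lambda>j. u (k + j)))
       \<or> (\<exists>d. n - \<omega> \<le> d \<and> d \<le> n div 2 \<and> form_ii n \<omega> d (\<lambda>j. u (k + j))))"
proof -
  have u: "u (i + n) = u i" for i using assms(5) unfolding least_period_def by blast
  define run where "run a d \<longleftrightarrow> maximal_run (ext u n) (int \<omega>) a (int d)
    \<and> primitive_period (ext u n) a (a + int \<omega> + int d - 1) (int d)" for a d
  have run_mod: "run a d \<longleftrightarrow> run b d" if "a mod int n = b mod int n" for a b d
    using maximal_run_shift(1)[OF that, of u "int \<omega>" "int d"]
      maximal_run_shift(2)[OF that, of u "int \<omega> + int d - 1" "int d"]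
    unfolding run_def by (simp add: algebra_simps)
  have i: "form_i n \<omega> d (\<lambda>j. u (k + j)) \<longleftrightarrow> run (int k) d" if "1 \<le> d" for k d
    using form_i_iff[where u = u, OF u] that assms unfolding run_def by simp
  have ii: "form_ii n \<omega> d (\<lambda>j. u (k + j)) \<longleftrightarrow> run (int k - int (\<omega> + d - n)) d"
    if "n - \<omega> \<le> d" "d \<le> n div 2" for k d
    using that assms unfolding run_def by (intro form_ii_iff[where u = u, OF u]) auto
  \<comment> \<open>Both forms describe the same runs but start the block at different offsets
    \<open>c\<close>; reduction modulo \<open>n\<close> provides a natural starting index.\<close>
  have shift: "\<exists>k. run (int k - c) d" if "run a d" for a c d
  proof
    show "run (int (nat ((a + c) mod int n)) - c) d"
      using that assms(1) by (subst run_mod[of _ a]) (auto simp: mod_simps)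
  qed
  have "nlc u = \<omega> \<longleftrightarrow> (\<exists>a d. 0 < d \<and> 2 * d \<le> n \<and> run a d)"
  proof -
    have "(\<exists>a d. 0 < d \<and> 2 * d \<le> int n \<and> P a d) \<longleftrightarrow> (\<exists>a d. 0 < d \<and> 2 * d \<le> n \<and> P a (int d))"
      for P :: "int \<Rightarrow> int \<Rightarrow> bool"
    proof
      assume "\<exists>a d. 0 < d \<and> 2 * d \<le> int n \<and> P a d"
      then obtain a d where "0 < d" "2 * d \<le> int n" "P a d" by blast
      then show "\<exists>a d. 0 < d \<and> 2 * d \<le> n \<and> P a (int d)"
        by (intro exI[of _ a] exI[of _ "nat d"]) auto
    next
      assume "\<exists>a d. 0 < d \<and> 2 * d \<le> n \<and> P a (int d)"
      then obtain a d where "0 < d" "2 * d \<le> n" "P a (int d)" by blast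
      then show "\<exists>a d. 0 < d \<and> 2 * d \<le> int n \<and> P a d"
        by (intro exI[of _ a] exI[of _ "int d"]) auto
    qed
    from this[of "\<lambda>a d. maximal_run (ext u n) (int \<omega>) a d
        \<and> primitive_period (ext u n) a (a + int \<omega> + d - 1) d"]
    show ?thesis
      unfolding nlc_eq_iff_maximal_run[where u = u, OF u assms(1-3)] run_def .
  qed
  also have "\<dots> \<longleftrightarrow> (\<exists>k. (\<exists>d. 1 \<le> d \<and> d \<le> n - \<omega> - 1 \<and> form_i n \<omega> d (\<lambda>j. u (k + j)))
       \<or> (\<exists>d. n - \<omega> \<le> d \<and> d \<le> n div 2 \<and> form_ii n \<omega> d (\<lambda>j. u (k + j))))"
  proof
    assume "\<exists>a d. 0 < d \<and> 2 * d \<le> n \<and> run a d"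
    then obtain a d where d: "0 < d" "2 * d \<le> n" and "run a d" by blast
    obtain k1 where k1: "run (int k1) d" using shift[OF \<open>run a d\<close>, of 0] by auto
    obtain k2 where k2: "run (int k2 - int (\<omega> + d - n)) d" using shift[OF \<open>run a d\<close>] by blast
    show "\<exists>k. (\<exists>d. 1 \<le> d \<and> d \<le> n - \<omega> - 1 \<and> form_i n \<omega> d (\<lambda>j. u (k + j)))
       \<or> (\<exists>d. n - \<omega> \<le> d \<and> d \<le> n div 2 \<and> form_ii n \<omega> d (\<lambda>j. u (k + j)))"
    proof (cases "d \<le> n - \<omega> - 1")
      case True
      then show ?thesis using i[of d k1] k1 d by (metis One_nat_def Suc_leI)
    next
      case False
      then have "n - \<omega> \<le> d" "d \<le> n div 2" using d assms by auto
      then show ?thesis using ii[of d k2] k2 by blast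
    qed
  next
    assume "\<exists>k. (\<exists>d. 1 \<le> d \<and> d \<le> n - \<omega> - 1 \<and> form_i n \<omega> d (\<lambda>j. u (k + j)))
       \<or> (\<exists>d. n - \<omega> \<le> d \<and> d \<le> n div 2 \<and> form_ii n \<omega> d (\<lambda>j. u (k + j)))"
    then obtain k d where "(1 \<le> d \<and> d \<le> n - \<omega> - 1 \<and> form_i n \<omega> d (\<lambda>j. u (k + j)))
       \<or> (n - \<omega> \<le> d \<and> d \<le> n div 2 \<and> form_ii n \<omega> d (\<lambda>j. u (k + j)))" by blast
    then show "\<exists>a d. 0 < d \<and> 2 * d \<le> n \<and> run a d"
    proof
      assume d: "1 \<le> d \<and> d \<le> n - \<omega> - 1 \<and> form_i n \<omega> d (\<lambda>j. u (k + j))"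
      \<comment> \<open>The lower bound on \<open>\<omega>\<close> makes every shift of form (i) at
        most half the period.\<close>
      moreover have "2 * (n - \<omega> - 1) \<le> n" using assms by linarith
      ultimately show ?thesis using i[of d k] by (intro exI[of _ "int k"] exI[of _ d]) auto
    next
      assume d: "n - \<omega> \<le> d \<and> d \<le> n div 2 \<and> form_ii n \<omega> d (\<lambda>j. u (k + j))"
      then have "0 < d" "2 * d \<le> n" using assms by auto
      then show ?thesis using ii[of d k] d by blast
    qed
  qed
  finally show ?thesis .
qed

end
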